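(* Let $\mu>-1$, $q\ge0$ and $0<\gamma<1$. There is a unique $\theta_*=\theta_*(\mu,q,\gamma)\in(\gamma,1)$ satisfying $$K_{\mu,q}\exp\left(\frac{2\gamma(\mu+2)\theta_*}{1-\theta_*}\right)=\frac{\mu+1+\theta_*}{(\mu+2)\theta_*(\theta_*-\gamma)}.$$ Moreover, $\widehat M_{\mu,q,\gamma}=M_{\mu,q,\gamma}(\theta_* )$ and $M^*_{\mu,q,\gamma}\le\widehat M_{\mu,q,\gamma}$.
   Context: $I_\alpha(x)=\sum_{k=0}^{\infty}\frac{(x/2)^{2k+\alpha}}{k!\,\Gamma(k+\alpha+1)}$, $x>0$, is the modified Bessel function of the first kind. $K_{\mu,q}=\max\{1,\frac{2(\mu+1)}{q+1}\}$. For $\mu>-1$, $q\ge0$ and $0<\gamma<\theta<1$, $$M_{\mu,q,\gamma}(\theta)=\max\left\{K_{\mu,q}\exp\left(\frac{2\gamma(\mu+2)\theta}{1-\theta}\right),\ \frac{\mu+1+\theta}{(\mu+2)\theta(\theta-\gamma)}\right\},\qquad \widehat M_{\mu,q,\gamma}=\inf_{\gamma<\theta<1}M_{\mu,q,\gamma}(\theta).$$ Further, $$M^*_{\mu,q,\gamma}=\sup_{x>0}\frac{\int_0^x e^{-\gamma t}t^{q-\mu}I_\mu(t)\,dt}{e^{-\gamma x}x^{q-\mu}I_{\mu+1}(x)}.$$ *)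

theory Defs
  imports "HOL-Analysis.Analysis"
begin

definition bessel_I :: "real \<Rightarrow> real \<Rightarrow> real" where
  "bessel_I \<alpha> x = (\<Sum>k. (x / 2) powr (2 * real k + \<alpha>) / (fact k * Gamma (real k + \<alpha> + 1)))"

definition K_const :: "real \<Rightarrow> real \<Rightarrow> real" where
  "K_const \<mu> q = max 1 (2 * (\<mu> + 1) / (q + 1))"

definition M_fun :: "real \<Rightarrow> real \<Rightarrow> real \<Rightarrow> real \<Rightarrow> real" where
  "M_fun \<mu> q \<gamma> \<theta> =
     max (K_const \<mu> q * exp (2 * \<gamma> * (\<mu> + 2) * \<theta> / (1 - \<theta>)))
         ((\<mu> + 1 + \<theta>) / ((\<mu> + 2) * \<theta> * (\<theta> - \<gamma>)))"

(* For mu > -1 and 0 < gamma < 1 the infimum is over a nonempty set of positive numbers,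
   so the conditionally complete infimum on the reals is the ordinary one. *)
definition M_hat :: "real \<Rightarrow> real \<Rightarrow> real \<Rightarrow> real" where
  "M_hat \<mu> q \<gamma> = (INF \<theta>\<in>{\<gamma><..<1}. M_fun \<mu> q \<gamma> \<theta>)"

(* Taken in the extended reals, so that an upper bound on M_star also asserts that the
   quotients are bounded; the supremum of an unbounded set of type real is unspecified.
   For mu > -1 and q >= 0 the integrand is of order t powr q at 0, hence integrable. *)
definition M_star :: "real \<Rightarrow> real \<Rightarrow> real \<Rightarrow> ereal" where
  "M_star \<mu> q \<gamma> =
     (SUP x\<in>{0<..}. ereal
        ((LBINT t:{0<..<x}. exp (- \<gamma> * t) * t powr (q - \<mu>) * bessel_I \<mu> t)
           / (exp (- \<gamma> * x) * x powr (q - \<mu>) * bessel_I (\<mu> + 1) x)))"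

end

theory Submission
  imports Defs
begin

text \<open>
  Write \<open>y = x / 2\<close> and \<open>I\<^sub>a(x) = y\<^sup>a B\<^sub>a(y\<^sup>2)\<close> with an entire function \<open>B\<^sub>a\<close>.
  Let \<open>F(x)\<close> be the integral in the numerator of the quotient defining \<open>M_star\<close>, and
  \<open>G(x)\<close> its denominator. The bound \<open>F \<le> M_fun \<mu> q \<gamma> \<theta> \<cdot> G\<close> holds for every
  \<open>\<theta>\<close> in \<open>(\<gamma>, 1)\<close>; the two entries of the maximum in \<open>M_fun\<close> come from two ranges of
  \<open>x\<close>, which meet at \<open>x\<^sub>0 = 2 (\<mu> + 2) \<theta> / (1 - \<theta>)\<close>.

  For \<open>x \<le> x\<^sub>0\<close> the factor \<open>exp (- \<gamma> t)\<close> is thrown away. The undamped integral of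
  \<open>t powr (q - \<mu>) \<cdot> I\<^sub>\<mu>(t)\<close> is at most \<open>K_const \<mu> q \<cdot> x powr (q - \<mu>) \<cdot> I\<^sub>\<mu>\<^sub>+\<^sub>1(x)\<close>, because
  the recurrence \<open>B\<^sub>\<mu> = (\<mu> + 1) B\<^sub>\<mu>\<^sub>+\<^sub>1 + z B\<^sub>\<mu>\<^sub>+\<^sub>2\<close> gives the corresponding inequality between
  derivatives (\<open>damped_le_undamped_slope\<close>); putting the exponential back costs at most
  \<open>exp (\<gamma> x\<^sub>0)\<close>.

  For \<open>x \<ge> x\<^sub>0\<close> one compares derivatives again, now with the damping kept: \<open>G'\<close> equals
  \<open>exp (- \<gamma> x) x powr (q - \<mu>) (I\<^sub>\<mu>\<^sub>+\<^sub>2 + ((q + 1) / x - \<gamma>) I\<^sub>\<mu>\<^sub>+\<^sub>1)\<close>. The lower bound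
  \<open>I\<^sub>a\<^sub>+\<^sub>1 / I\<^sub>a \<ge> x / (2 (a + 1) + x)\<close> (\<open>bessel_clifford_ratio_bound\<close>) gives
  \<open>I\<^sub>\<mu>\<^sub>+\<^sub>2 \<ge> \<theta> I\<^sub>\<mu>\<^sub>+\<^sub>1\<close> and \<open>I\<^sub>\<mu>\<^sub>+\<^sub>1 \<ge> (\<mu> + 2) \<theta> / (\<mu> + 1 + \<theta>) I\<^sub>\<mu>\<close> from \<open>x\<^sub>0\<close> on, so \<open>G'\<close>
  dominates the integrand divided by the second entry of the maximum
  (\<open>damped_le_damped_slope\<close>), and an inequality that holds at \<open>x\<^sub>0\<close> persists.

  As \<open>\<theta>\<close> runs through \<open>(\<gamma>, 1)\<close> the exponential entry increases strictly up to infinity and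
  the rational entry decreases strictly from infinity. They therefore cross exactly once,
  and the maximum of an increasing and a decreasing function is least where they cross.
\<close>

section \<open>The Bessel-Clifford function\<close>

text \<open>
  The entire part of \<open>I\<^sub>a\<close>. In contrast to \<open>I\<^sub>a\<close>, which behaves like \<open>x powr a\<close> at the
  origin, it is smooth there, and its derivative is the same function with index \<open>a + 1\<close>.
\<close>

definition bessel_clifford :: "real \<Rightarrow> real \<Rightarrow> real" where
  "bessel_clifford a z = (\<Sum>k. z ^ k / (fact k * Gamma (real k + a + 1)))"

lemma Gamma_index_Suc:
  fixes a :: real
  assumes "a > -1"
  shows "Gamma (real k + a + 2) = (real k + a + 1) * Gamma (real k + a + 1)"
proof -
  have "real k + a + 1 \<notin> \<int>\<^sub>\<le>\<^sub>0"
    using assms by (auto elim!: nonpos_Ints_cases)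
  from Gamma_plus1[OF this] show ?thesis by (simp add: add.assoc)
qed

lemma summable_bessel_clifford:
  fixes a z :: real
  assumes "a > -1"
  shows "summable (\<lambda>k. z ^ k / (fact k * Gamma (real k + a + 1)))"
proof (rule summable_ratio_test[where c = "1/2" and N = "Suc (nat \<lceil>2 * \<bar>z\<bar>\<rceil>)"])
  fix n assume n: "n \<ge> Suc (nat \<lceil>2 * \<bar>z\<bar>\<rceil>)"
  define t where "t = \<bar>z\<bar> ^ n / (fact n * Gamma (real n + a + 1))"
  have G: "Gamma (real n + a + 1) > 0" using assms by (intro Gamma_real_pos) auto
  have t: "t \<ge> 0" unfolding t_def using G by simp
  have zn: "2 * \<bar>z\<bar> \<le> real n" "real n \<ge> 1" using n by linarith+
  have "2 * \<bar>z\<bar> \<le> real n * 1" using zn by simp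
  also have "\<dots> \<le> (real n + a + 1) * (real n + 1)"
    using zn assms by (intro mult_mono) auto
  finally have *: "\<bar>z\<bar> / ((real n + 1) * (real n + a + 1)) \<le> 1/2"
    using zn assms by (subst pos_divide_le_eq) (auto simp: mult_ac)
  have "Gamma (real (Suc n) + a + 1) = (real n + a + 1) * Gamma (real n + a + 1)"
    using Gamma_index_Suc[OF assms, of n] by (simp add: add_ac)
  moreover have "\<bar>real n + a + 1\<bar> = real n + a + 1" "\<bar>1 + real n\<bar> = real n + 1"
    using zn assms by simp_all
  ultimately have "norm (z ^ Suc n / (fact (Suc n) * Gamma (real (Suc n) + a + 1)))
      = \<bar>z\<bar> / ((real n + 1) * (real n + a + 1)) * t"
    using G by (simp add: t_def abs_mult power_abs mult_ac)
  also have "\<dots> \<le> 1/2 * t" by (rule mult_right_mono[OF * t])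
  also have "t = norm (z ^ n / (fact n * Gamma (real n + a + 1)))"
    using G by (simp add: t_def abs_mult power_abs)
  finally show "norm (z ^ Suc n / (fact (Suc n) * Gamma (real (Suc n) + a + 1)))
      \<le> 1/2 * norm (z ^ n / (fact n * Gamma (real n + a + 1)))" .
qed simp

lemma bessel_clifford_pos:
  assumes "a > -1" "z \<ge> 0"
  shows "bessel_clifford a z > 0"
proof -
  have G: "Gamma (real k + a + 1) > 0" for k
    using assms by (intro Gamma_real_pos) auto
  show ?thesis unfolding bessel_clifford_def
  proof (rule suminf_pos2[where i = 0])
    show "summable (\<lambda>k. z ^ k / (fact k * Gamma (real k + a + 1)))"
      by (rule summable_bessel_clifford[OF assms(1)])
  qed (use G[of 0] G assms in \<open>auto simp: less_imp_le\<close>)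
qed

text \<open>
  Differentiating \<open>z\<^sup>k\<^sup>+\<^sup>1 / (k + 1)!\<close> gives \<open>z\<^sup>k / k!\<close> and leaves the Gamma factor of the term
  \<open>k + 1\<close>, which is the one that belongs to index \<open>a + 1\<close> and term \<open>k\<close>.
\<close>

lemma has_real_derivative_bessel_clifford:
  assumes "a > -1"
  shows "(bessel_clifford a has_real_derivative bessel_clifford (a + 1) z) (at z)"
proof -
  define c where "c = (\<lambda>k. 1 / (fact k * Gamma (real k + a + 1)))"
  have "((\<lambda>z. \<Sum>k. c k * z ^ k) has_real_derivative (\<Sum>k. diffs c k * z ^ k)) (at z)"
    using summable_bessel_clifford[OF assms]
    by (intro termdiffs_strong_converges_everywhere) (simp add: c_def)
  moreover have "diffs c k * z ^ k = z ^ k / (fact k * Gamma (real k + (a + 1) + 1))" for k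
    by (simp add: diffs_def c_def divide_simps del: of_nat_Suc) (simp add: add_ac)
  ultimately show ?thesis by (simp add: bessel_clifford_def[abs_def] c_def)
qed

text \<open>
  In the term of index \<open>k\<close>, expand \<open>\<Gamma>(k + a + 2) = ((a + 1) + k) \<Gamma>(k + a + 1)\<close>; the part
  carrying \<open>k\<close> cancels against \<open>k!\<close> and is \<open>z\<close> times a series with shifted index.
\<close>

lemma bessel_clifford_recurrence:
  assumes "a > -1"
  shows "bessel_clifford a z
           = (a + 1) * bessel_clifford (a + 1) z + z * bessel_clifford (a + 2) z"
proof -
  let ?T = "\<lambda>a k. z ^ k / (fact k * Gamma (real k + a + 1))"
  have S: "(?T b) sums bessel_clifford b z" if "b > -1" for b
    unfolding bessel_clifford_def
    by (rule summable_sums, rule summable_bessel_clifford[OF that])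
  have "real (Suc k) * ?T (a + 1) (Suc k) = z * ?T (a + 2) k" for k
    by (simp add: divide_simps del: of_nat_Suc) (simp add: add_ac)
  then have "(\<lambda>k. real (Suc k) * ?T (a + 1) (Suc k)) sums (z * bessel_clifford (a + 2) z)"
    using sums_mult[OF S[of "a + 2"], of z] assms by simp
  then have "(\<lambda>k. real k * ?T (a + 1) k) sums (z * bessel_clifford (a + 2) z)"
    by (subst (asm) sums_Suc_iff) simp
  moreover have "(\<lambda>k. (a + 1) * ?T (a + 1) k) sums ((a + 1) * bessel_clifford (a + 1) z)"
    using assms by (intro sums_mult S) auto
  ultimately have "(\<lambda>k. (a + 1) * ?T (a + 1) k + real k * ?T (a + 1) k) sums
      ((a + 1) * bessel_clifford (a + 1) z + z * bessel_clifford (a + 2) z)"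
    by (intro sums_add)
  moreover have "(a + 1) * ?T (a + 1) k + real k * ?T (a + 1) k = ?T a k" for k
  proof -
    have "Gamma (real k + (a + 1) + 1) = (real k + a + 1) * Gamma (real k + a + 1)"
      using Gamma_index_Suc[OF assms, of k] by (simp add: add_ac)
    moreover have "real k + a + 1 > 0" "Gamma (real k + a + 1) > 0"
      using assms by (auto intro!: Gamma_real_pos)
    ultimately show ?thesis
      by (simp add: divide_simps) (simp add: algebra_simps)
  qed
  ultimately show ?thesis using S[OF assms] by (simp add: sums_iff)
qed

lemma bessel_I_eq_bessel_clifford:
  assumes "x > 0" "a > -1"
  shows "bessel_I a x = (x / 2) powr a * bessel_clifford a (x\<^sup>2 / 4)"
proof -
  have "(x / 2) powr (2 * real k + a) / (fact k * Gamma (real k + a + 1))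
      = (x / 2) powr a * ((x\<^sup>2 / 4) ^ k / (fact k * Gamma (real k + a + 1)))" for k
  proof -
    have "(x / 2) powr (2 * real k) = (x / 2) ^ (2 * k)"
      using assms by (simp flip: powr_realpow)
    also have "\<dots> = (x\<^sup>2 / 4) ^ k" by (simp add: power_mult power_divide)
    finally show ?thesis by (simp add: powr_add)
  qed
  then show ?thesis unfolding bessel_I_def bessel_clifford_def
    by (simp only: suminf_mult[OF summable_bessel_clifford[OF assms(2)]])
qed

section \<open>Ratios of Bessel functions of neighbouring order\<close>

text \<open>
  In Bessel notation this is \<open>I\<^sub>a\<^sub>+\<^sub>1(2y) \<le> I\<^sub>a(2y)\<close>. By the recurrence the difference
  \<open>D\<close> of the two sides satisfies \<open>D' = - 2 D + (2 a + 1) B\<^sub>a\<^sub>+\<^sub>1\<close>, hence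
  \<open>exp (2 y) D(y)\<close> is nondecreasing as soon as \<open>a \<ge> -1/2\<close>, and \<open>D(0) = B\<^sub>a(0) > 0\<close>.
\<close>

lemma bessel_clifford_index_mono:
  assumes "a \<ge> -1/2" "y \<ge> 0"
  shows "y * bessel_clifford (a + 1) (y\<^sup>2) \<le> bessel_clifford a (y\<^sup>2)"
proof -
  define D where "D = (\<lambda>y. bessel_clifford a (y\<^sup>2) - y * bessel_clifford (a + 1) (y\<^sup>2))"
  have deriv: "((\<lambda>y. exp (2 * y) * D y) has_real_derivative
      exp (2 * y) * ((2 * a + 1) * bessel_clifford (a + 1) (y\<^sup>2))) (at y)" for y
  proof -
    have 1: "(bessel_clifford a has_real_derivative bessel_clifford (a + 1) z) (at z)"
      and 2: "(bessel_clifford (a + 1) has_real_derivative bessel_clifford (a + 2) z) (at z)" for z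
      using has_real_derivative_bessel_clifford[of a z]
            has_real_derivative_bessel_clifford[of "a + 1" z] assms by (simp_all add: add_ac)
    note [derivative_intros] = DERIV_chain2[OF 1] DERIV_chain2[OF 2]
    have rec: "bessel_clifford a (y\<^sup>2)
        = (a + 1) * bessel_clifford (a + 1) (y\<^sup>2) + y\<^sup>2 * bessel_clifford (a + 2) (y\<^sup>2)"
      using assms by (intro bessel_clifford_recurrence) auto
    show ?thesis unfolding D_def
      by (rule derivative_eq_intros refl | simp)+
         (simp only: rec, simp add: algebra_simps power2_eq_square)
  qed
  have "exp (2 * 0) * D 0 \<le> exp (2 * y) * D y"
  proof (rule DERIV_nonneg_imp_nondecreasing[OF assms(2)])
    fix u :: real assume "0 \<le> u" "u \<le> y"
    have "exp (2 * u) * ((2 * a + 1) * bessel_clifford (a + 1) (u\<^sup>2)) \<ge> 0"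
      using assms bessel_clifford_pos[of "a + 1" "u\<^sup>2"] by simp
    with deriv show "\<exists>d. ((\<lambda>y. exp (2 * y) * D y) has_real_derivative d) (at u) \<and> 0 \<le> d"
      by blast
  qed
  moreover have "D 0 > 0" using bessel_clifford_pos[of a 0] assms by (simp add: D_def)
  ultimately have "0 < exp (2 * y) * D y" by simp
  then show ?thesis by (simp add: D_def zero_less_mult_iff)
qed

text \<open>
  With \<open>x = 2 y\<close> this is the bound \<open>I\<^sub>a\<^sub>+\<^sub>1(x) / I\<^sub>a(x) \<ge> x / (2 (a + 1) + x)\<close>. The recurrence
  turns it into \<open>I\<^sub>a\<^sub>+\<^sub>2 \<le> I\<^sub>a\<^sub>+\<^sub>1\<close>, which is why monotonicity in the index is only ever needed
  above index 0, although \<open>a\<close> may be close to \<open>-1\<close>.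
\<close>

lemma bessel_clifford_ratio_bound:
  assumes "a > -1" "y \<ge> 0"
  shows "bessel_clifford a (y\<^sup>2) \<le> (a + 1 + y) * bessel_clifford (a + 1) (y\<^sup>2)"
proof -
  have "y * (y * bessel_clifford (a + 2) (y\<^sup>2)) \<le> y * bessel_clifford (a + 1) (y\<^sup>2)"
    using bessel_clifford_index_mono[of "a + 1" y] assms
    by (intro mult_left_mono) (auto simp: add_ac)
  then show ?thesis
    using bessel_clifford_recurrence[OF assms(1), of "y\<^sup>2"]
    by (simp add: algebra_simps power2_eq_square)
qed

section \<open>Comparing an integral with an increment\<close>

text \<open>
  The derivative of \<open>\<Phi>\<close> may be unbounded at the end points; being nonnegative with a
  continuous antiderivative makes it integrable, and it then dominates \<open>f\<close>.
  Integrability of \<open>f\<close> is part of the conclusion since integrals over adjacent intervals are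
  added later.
\<close>

lemma integral_le_increment:
  fixes f \<Phi> \<phi> :: "real \<Rightarrow> real"
  assumes ab: "a < b"
    and deriv: "\<And>t. a < t \<Longrightarrow> t < b \<Longrightarrow> (\<Phi> has_real_derivative \<phi> t) (at t)"
    and cont\<phi>: "continuous_on {a<..<b} \<phi>"
    and cont\<Phi>: "continuous_on {a..b} \<Phi>"
    and contf: "continuous_on {a<..<b} f"
    and f: "\<And>t. a < t \<Longrightarrow> t < b \<Longrightarrow> 0 \<le> f t \<and> f t \<le> \<phi> t"
  shows "set_integrable lborel {a<..<b} f"
    and "(LBINT t:{a<..<b}. f t) \<le> \<Phi> b - \<Phi> a"
proof -
  have "(\<Phi> \<longlongrightarrow> \<Phi> a) (at_right a)" "(\<Phi> \<longlongrightarrow> \<Phi> b) (at_left b)"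
    using cont\<Phi> ab by (auto simp: continuous_on_Icc_at_rightD continuous_on_Icc_at_leftD)
  then have lim: "((\<Phi> \<circ> real_of_ereal) \<longlongrightarrow> \<Phi> a) (at_right (ereal a))"
      "((\<Phi> \<circ> real_of_ereal) \<longlongrightarrow> \<Phi> b) (at_left (ereal b))"
    by (simp_all add: ereal_tendsto_simps)
  have isC: "isCont \<phi> t" if "a < t" "t < b" for t
    using cont\<phi> that by (simp add: continuous_on_eq_continuous_at)
  have nn: "AE t in lborel. ereal a < ereal t \<longrightarrow> ereal t < ereal b \<longrightarrow> 0 \<le> \<phi> t"
    using f by (intro AE_I2) (auto intro: order_trans)
  have int\<phi>: "set_integrable lborel {a<..<b} \<phi>"
    and eq: "(LBINT t:{a<..<b}. \<phi> t) = \<Phi> b - \<Phi> a"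
    using interval_integral_FTC_nonneg[of "ereal a" "ereal b" \<Phi> \<phi> "\<Phi> a" "\<Phi> b"]
      ab deriv isC nn lim
    by (simp_all add: interval_lebesgue_integral_def)
  show intf: "set_integrable lborel {a<..<b} f"
  proof (rule set_integrable_bound[OF int\<phi>])
    show "set_borel_measurable lborel {a<..<b} f"
      using borel_measurable_continuous_on_indicator[OF _ contf]
      by (simp add: set_borel_measurable_def)
    show "AE t in lborel. t \<in> {a<..<b} \<longrightarrow> norm (f t) \<le> norm (\<phi> t)"
      using f by (intro AE_I2) force
  qed
  have "(LBINT t:{a<..<b}. f t) \<le> (LBINT t:{a<..<b}. \<phi> t)"
    using f by (intro set_integral_mono intf int\<phi>) auto
  with eq show "(LBINT t:{a<..<b}. f t) \<le> \<Phi> b - \<Phi> a" by simp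
qed

section \<open>The integrand, the denominator and its derivative\<close>

text \<open>
  The integrand of the theorem without the factor \<open>2 powr (- \<mu>)\<close>: the powers
  \<open>t powr (q - \<mu>)\<close> and \<open>t powr \<mu>\<close> combine, so that nothing singular is left at 0. Its value
  at \<open>t = 0\<close> when \<open>q = 0\<close>, where \<open>0 powr 0 = 0\<close>, is harmless because only open intervals are
  integrated over.
\<close>

definition damped :: "real \<Rightarrow> real \<Rightarrow> real \<Rightarrow> real \<Rightarrow> real" where
  "damped \<mu> q \<gamma> t = exp (- \<gamma> * t) * t powr q * bessel_clifford \<mu> (t\<^sup>2 / 4)"

text \<open>
  The denominator of the theorem with the same factor \<open>2 powr (- \<mu>)\<close> removed; the division by
  2 remains because the Bessel function there has order \<open>\<mu> + 1\<close>.
\<close>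

definition comparison :: "real \<Rightarrow> real \<Rightarrow> real \<Rightarrow> real \<Rightarrow> real" where
  "comparison \<mu> q \<gamma> t = damped (\<mu> + 1) (q + 1) \<gamma> t / 2"

definition comparison_slope :: "real \<Rightarrow> real \<Rightarrow> real \<Rightarrow> real \<Rightarrow> real" where
  "comparison_slope \<mu> q \<gamma> t = exp (- \<gamma> * t) * t powr q / 2 *
     ((q + 1 - \<gamma> * t) * bessel_clifford (\<mu> + 1) (t\<^sup>2 / 4)
        + t\<^sup>2 / 2 * bessel_clifford (\<mu> + 2) (t\<^sup>2 / 4))"

lemma continuous_on_bessel_clifford [continuous_intros]:
  assumes "a > -1" "continuous_on S f"
  shows "continuous_on S (\<lambda>x. bessel_clifford a (f x))"
proof -
  have "continuous_on UNIV (bessel_clifford a)"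
    using has_real_derivative_bessel_clifford[OF assms(1)]
    by (meson DERIV_isCont continuous_at_imp_continuous_on)
  from continuous_on_compose2[OF this assms(2)] show ?thesis by simp
qed

lemma has_real_derivative_comparison:
  assumes "\<mu> > -1" "t > 0"
  shows "(comparison \<mu> q \<gamma> has_real_derivative comparison_slope \<mu> q \<gamma> t) (at t)"
proof -
  have "(bessel_clifford (\<mu> + 1) has_real_derivative bessel_clifford (\<mu> + 2) z) (at z)" for z
    using has_real_derivative_bessel_clifford[of "\<mu> + 1" z] assms by (simp add: add_ac)
  note [derivative_intros] = DERIV_chain2[OF this]
  have pow: "((\<lambda>t. t powr (q + 1)) has_real_derivative (q + 1) * t powr q) (at t)"
    using has_real_derivative_powr[OF assms(2), of "q + 1"] by simp
  have e: "t powr (1 + q) = t * t powr q"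
    using assms by (simp add: powr_add)
  show ?thesis
    unfolding comparison_def[abs_def] damped_def[abs_def] comparison_slope_def
    by (rule pow derivative_eq_intros refl | simp)+
       (simp add: e algebra_simps power2_eq_square)
qed

lemma damped_nonneg: "a > -1 \<Longrightarrow> damped a q \<gamma> t \<ge> 0"
  using bessel_clifford_pos[of a "t\<^sup>2 / 4"] by (simp add: damped_def)

lemma comparison_pos: "\<mu> > -1 \<Longrightarrow> x > 0 \<Longrightarrow> comparison \<mu> q \<gamma> x > 0"
  using bessel_clifford_pos[of "\<mu> + 1" "x\<^sup>2 / 4"] by (simp add: comparison_def damped_def)

lemma continuous_on_comparison:
  assumes "\<mu> > -1" "q \<ge> 0"
  shows "continuous_on {0..} (comparison \<mu> q \<gamma>)"
  unfolding comparison_def[abs_def] damped_def[abs_def]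
  using assms by (intro continuous_intros continuous_on_powr') auto

lemma continuous_on_comparison_slope:
  assumes "\<mu> > -1"
  shows "continuous_on {0<..} (comparison_slope \<mu> q \<gamma>)"
  unfolding comparison_slope_def[abs_def]
  using assms by (intro continuous_intros) auto

lemma continuous_on_damped:
  assumes "\<mu> > -1"
  shows "continuous_on {0<..} (damped \<mu> q \<gamma>)"
  unfolding damped_def[abs_def]
  using assms by (intro continuous_intros) auto

section \<open>The two derivative comparisons\<close>

text \<open>
  The two damping rates are independent: rate \<open>\<delta> = 0\<close> serves the range near the origin and
  \<open>\<delta> = \<gamma>\<close> the range of large arguments.
\<close>

lemma integral_damped_le_comparison:
  assumes \<mu>: "\<mu> > -1" and q: "q \<ge> 0" and ab: "0 \<le> a" "a < b"
    and le: "\<And>t. a < t \<Longrightarrow> t < b \<Longrightarrow> damped \<mu> q \<gamma> t \<le> C * comparison_slope \<mu> q \<delta> t"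
  shows "set_integrable lborel {a<..<b} (damped \<mu> q \<gamma>)"
    and "(LBINT t:{a<..<b}. damped \<mu> q \<gamma> t)
           \<le> C * comparison \<mu> q \<delta> b - C * comparison \<mu> q \<delta> a"
proof -
  have "((\<lambda>t. C * comparison \<mu> q \<delta> t) has_real_derivative C * comparison_slope \<mu> q \<delta> t) (at t)"
    if "a < t" for t
    using that ab by (intro DERIV_cmult has_real_derivative_comparison \<mu>) auto
  moreover have "continuous_on {a<..<b} (\<lambda>t. C * comparison_slope \<mu> q \<delta> t)"
    "continuous_on {a<..<b} (damped \<mu> q \<gamma>)"
    "continuous_on {a..b} (\<lambda>t. C * comparison \<mu> q \<delta> t)"
    using ab \<mu> q
    by (auto intro!: continuous_intros
          intro: continuous_on_subset[OF continuous_on_comparison_slope[OF \<mu>]]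
                 continuous_on_subset[OF continuous_on_damped[OF \<mu>]]
                 continuous_on_subset[OF continuous_on_comparison[OF \<mu> q]])
  moreover have "0 \<le> damped \<mu> q \<gamma> t \<and> damped \<mu> q \<gamma> t \<le> C * comparison_slope \<mu> q \<delta> t"
    if "a < t" "t < b" for t
    using le[OF that] damped_nonneg[OF \<mu>] by simp
  ultimately show "set_integrable lborel {a<..<b} (damped \<mu> q \<gamma>)"
    "(LBINT t:{a<..<b}. damped \<mu> q \<gamma> t)
           \<le> C * comparison \<mu> q \<delta> b - C * comparison \<mu> q \<delta> a"
    using integral_le_increment[OF ab(2), of "\<lambda>t. C * comparison \<mu> q \<delta> t"
        "\<lambda>t. C * comparison_slope \<mu> q \<delta> t" "damped \<mu> q \<gamma>"] by blast+
qed

text \<open>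
  By the recurrence, twice the undamped integrand is \<open>t powr q\<close> times a combination of
  \<open>B\<^sub>\<mu>\<^sub>+\<^sub>1\<close> and \<open>(t\<^sup>2 / 2) B\<^sub>\<mu>\<^sub>+\<^sub>2\<close> with coefficients \<open>2 (\<mu> + 1)\<close> and \<open>1\<close>; for twice the slope the
  coefficients are \<open>q + 1\<close> and \<open>1\<close>. \<open>K_const\<close> is the larger of the two quotients.
\<close>

lemma damped_le_undamped_slope:
  assumes \<mu>: "\<mu> > -1" and q: "q \<ge> 0" and "\<gamma> \<ge> 0" "t > 0"
  shows "damped \<mu> q \<gamma> t \<le> K_const \<mu> q * comparison_slope \<mu> q 0 t"
proof -
  let ?B = "\<lambda>a. bessel_clifford a (t\<^sup>2 / 4)"
  have K: "K_const \<mu> q \<ge> 1" "K_const \<mu> q * (q + 1) \<ge> 2 * (\<mu> + 1)"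
  proof -
    have "2 * (\<mu> + 1) / (q + 1) \<le> K_const \<mu> q" by (simp add: K_const_def)
    then show "K_const \<mu> q * (q + 1) \<ge> 2 * (\<mu> + 1)" using q by (simp add: divide_le_eq)
  qed (simp add: K_const_def)
  have pos: "?B \<mu> > 0" "?B (\<mu> + 1) > 0" "?B (\<mu> + 2) > 0"
    using \<mu> by (auto intro!: bessel_clifford_pos)
  have "2 * ?B \<mu> = 2 * (\<mu> + 1) * ?B (\<mu> + 1) + 1 * (t\<^sup>2 / 2 * ?B (\<mu> + 2))"
    using bessel_clifford_recurrence[OF \<mu>, of "t\<^sup>2 / 4"] by (simp add: algebra_simps)
  also have "\<dots> \<le> K_const \<mu> q * (q + 1) * ?B (\<mu> + 1)
      + K_const \<mu> q * (t\<^sup>2 / 2 * ?B (\<mu> + 2))"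
    using K pos by (intro add_mono mult_right_mono) auto
  finally have B: "?B \<mu> \<le> K_const \<mu> q * ((q + 1) * ?B (\<mu> + 1) + t\<^sup>2 / 2 * ?B (\<mu> + 2)) / 2"
    by (simp add: algebra_simps)
  have "damped \<mu> q \<gamma> t \<le> 1 * t powr q * ?B \<mu>"
    unfolding damped_def using pos assms by (intro mult_right_mono) auto
  also have "\<dots> \<le> 1 * t powr q *
      (K_const \<mu> q * ((q + 1) * ?B (\<mu> + 1) + t\<^sup>2 / 2 * ?B (\<mu> + 2)) / 2)"
    by (intro mult_left_mono B) auto
  finally show ?thesis by (simp add: comparison_slope_def mult_ac)
qed

text \<open>
  The threshold is the point where the ratio bound for the index \<open>\<mu> + 1\<close> reaches \<open>\<theta>\<close>; at the
  same point the bound for the index \<open>\<mu>\<close> reaches \<open>(\<mu> + 2) \<theta> / (\<mu> + 1 + \<theta>)\<close>.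
  The first pays for the loss \<open>\<gamma>\<close> caused by the damping and leaves \<open>\<theta> - \<gamma>\<close>, the second
  converts order \<open>\<mu> + 1\<close> back to order \<open>\<mu>\<close>.
\<close>

lemma damped_le_damped_slope:
  assumes \<mu>: "\<mu> > -1" and q: "q \<ge> 0" and \<gamma>: "0 < \<gamma>" "\<gamma> < \<theta>" "\<theta> < 1"
    and t: "t \<ge> 2 * (\<mu> + 2) * \<theta> / (1 - \<theta>)"
  shows "damped \<mu> q \<gamma> t
           \<le> (\<mu> + 1 + \<theta>) / ((\<mu> + 2) * \<theta> * (\<theta> - \<gamma>)) * comparison_slope \<mu> q \<gamma> t"
proof -
  define y where "y = t / 2"
  have z: "t\<^sup>2 / 4 = y\<^sup>2" by (simp add: y_def power_divide)
  have ty: "t = 2 * y" by (simp add: y_def)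
  let ?B = "\<lambda>a. bessel_clifford a (y\<^sup>2)"
  have y\<theta>: "(\<mu> + 2) * \<theta> \<le> y * (1 - \<theta>)"
    using t \<gamma> by (simp add: y_def divide_le_eq algebra_simps)
  have "y * (1 - \<theta>) > 0" using y\<theta> \<mu> \<gamma> by (intro less_le_trans[OF _ y\<theta>]) simp
  then have y: "y > 0" using \<gamma> by (simp add: zero_less_mult_iff)
  have pos: "?B \<mu> > 0" "?B (\<mu> + 1) > 0" "?B (\<mu> + 2) > 0"
    using \<mu> by (auto intro!: bessel_clifford_pos)
  have r1: "?B \<mu> \<le> (\<mu> + 1 + y) * ?B (\<mu> + 1)"
    using bessel_clifford_ratio_bound[OF \<mu>, of y] y by simp
  have r2: "?B (\<mu> + 1) \<le> (\<mu> + 2 + y) * ?B (\<mu> + 2)"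
    using bessel_clifford_ratio_bound[of "\<mu> + 1" y] \<mu> y by (simp add: add_ac)
  have "\<theta> * ?B (\<mu> + 1) \<le> \<theta> * ((\<mu> + 2 + y) * ?B (\<mu> + 2))"
    using r2 \<gamma> by (intro mult_left_mono) auto
  also have "\<dots> = (\<theta> * (\<mu> + 2 + y)) * ?B (\<mu> + 2)" by simp
  also have "\<dots> \<le> y * ?B (\<mu> + 2)"
    using y\<theta> pos by (intro mult_right_mono) (auto simp: algebra_simps)
  finally have B1: "\<theta> * ?B (\<mu> + 1) \<le> y * ?B (\<mu> + 2)" .
  have "(\<mu> + 1) * ((\<mu> + 2) * \<theta>) \<le> (\<mu> + 1) * (y * (1 - \<theta>))"
    using y\<theta> \<mu> by (intro mult_left_mono) auto
  \<comment> \<open>the ratio bound for index \<open>\<mu>\<close>: \<open>(\<mu> + 2) \<theta> / (\<mu> + 1 + \<theta>) \<le> y / (\<mu> + 1 + y)\<close>\<close>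
  then have frac: "(\<mu> + 2) * \<theta> * (\<mu> + 1 + y) \<le> y * (\<mu> + 1 + \<theta>)"
    by (simp add: algebra_simps)
  have "(\<mu> + 2) * \<theta> * ?B \<mu> \<le> (\<mu> + 2) * \<theta> * ((\<mu> + 1 + y) * ?B (\<mu> + 1))"
    using r1 \<mu> \<gamma> by (intro mult_left_mono) auto
  also have "\<dots> = ((\<mu> + 2) * \<theta> * (\<mu> + 1 + y)) * ?B (\<mu> + 1)" by simp
  also have "\<dots> \<le> (y * (\<mu> + 1 + \<theta>)) * ?B (\<mu> + 1)"
    using frac pos by (intro mult_right_mono) auto
  finally have B0: "(\<mu> + 2) * \<theta> * ?B \<mu> \<le> (y * (\<mu> + 1 + \<theta>)) * ?B (\<mu> + 1)" .
  have "(\<mu> + 2) * \<theta> * (\<theta> - \<gamma>) * ?B \<mu> = (\<theta> - \<gamma>) * ((\<mu> + 2) * \<theta> * ?B \<mu>)" by simp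
  also have "\<dots> \<le> (\<theta> - \<gamma>) * ((y * (\<mu> + 1 + \<theta>)) * ?B (\<mu> + 1))"
    using B0 \<gamma> by (intro mult_left_mono) auto
  also have "\<dots> = (\<mu> + 1 + \<theta>) * (y * (\<theta> * ?B (\<mu> + 1) - \<gamma> * ?B (\<mu> + 1)))"
    by (simp add: algebra_simps)
  also have "\<dots> \<le> (\<mu> + 1 + \<theta>) * (y * (y * ?B (\<mu> + 2) - \<gamma> * ?B (\<mu> + 1)))"
    using B1 y \<mu> \<gamma> by (intro mult_left_mono) auto
  also have "\<dots> \<le> (\<mu> + 1 + \<theta>) *
      (((q + 1 - \<gamma> * t) * ?B (\<mu> + 1) + t\<^sup>2 / 2 * ?B (\<mu> + 2)) / 2)"
  proof (intro mult_left_mono)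
    \<comment> \<open>twice the left side is the right side's bracket without the contribution of \<open>q + 1\<close>\<close>
    have "(q + 1) * ?B (\<mu> + 1) \<ge> 0" using q pos by simp
    then show "y * (y * ?B (\<mu> + 2) - \<gamma> * ?B (\<mu> + 1))
        \<le> ((q + 1 - \<gamma> * t) * ?B (\<mu> + 1) + t\<^sup>2 / 2 * ?B (\<mu> + 2)) / 2"
      by (simp add: ty power2_eq_square algebra_simps)
  qed (use \<mu> \<gamma> in auto)
  finally have "?B \<mu> \<le> (\<mu> + 1 + \<theta>) *
      (((q + 1 - \<gamma> * t) * ?B (\<mu> + 1) + t\<^sup>2 / 2 * ?B (\<mu> + 2)) / 2)
        / ((\<mu> + 2) * \<theta> * (\<theta> - \<gamma>))"
    using \<mu> \<gamma> by (subst pos_le_divide_eq) (auto simp: mult_ac)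
  from mult_left_mono[OF this, of "exp (- \<gamma> * t) * t powr q"] show ?thesis
    by (simp add: damped_def comparison_slope_def z mult_ac)
qed

section \<open>The bound for each parameter\<close>

lemma integral_damped_le_M_fun:
  assumes \<mu>: "\<mu> > -1" and q: "q \<ge> 0" and \<gamma>: "0 < \<gamma>" "\<gamma> < \<theta>" "\<theta> < 1" and x: "x > 0"
  shows "(LBINT t:{0<..<x}. damped \<mu> q \<gamma> t) \<le> M_fun \<mu> q \<gamma> \<theta> * comparison \<mu> q \<gamma> x"
proof -
  define x0 where "x0 = 2 * (\<mu> + 2) * \<theta> / (1 - \<theta>)"
  have x0: "x0 > 0" using \<mu> \<gamma> by (simp add: x0_def)
  have und: "damped \<mu> q \<gamma> t \<le> K_const \<mu> q * comparison_slope \<mu> q 0 t" if "t > 0" for t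
    using damped_le_undamped_slope[OF \<mu> q _ that] \<gamma> by simp
  have zero: "comparison \<mu> q \<delta> 0 = 0" for \<delta>
    by (simp add: comparison_def damped_def)
  have small: "(LBINT t:{0<..<u}. damped \<mu> q \<gamma> t) \<le> M_fun \<mu> q \<gamma> \<theta> * comparison \<mu> q \<gamma> u"
    if u: "0 < u" "u \<le> x0" for u
  proof -
    have "(LBINT t:{0<..<u}. damped \<mu> q \<gamma> t) \<le> K_const \<mu> q * comparison \<mu> q 0 u"
      using integral_damped_le_comparison(2)[OF \<mu> q order_refl u(1) und] by (simp add: zero)
    \<comment> \<open>restoring the damping in the denominator\<close>
    also have "\<dots> = K_const \<mu> q * exp (\<gamma> * u) * comparison \<mu> q \<gamma> u"
      by (simp add: comparison_def damped_def exp_minus)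
    also have "\<dots> \<le> M_fun \<mu> q \<gamma> \<theta> * comparison \<mu> q \<gamma> u"
    proof (intro mult_right_mono)
      have "K_const \<mu> q * exp (\<gamma> * u) \<le> K_const \<mu> q * exp (\<gamma> * x0)"
        using u \<gamma> by (intro mult_left_mono) (auto simp: K_const_def)
      also have "\<gamma> * x0 = 2 * \<gamma> * (\<mu> + 2) * \<theta> / (1 - \<theta>)" by (simp add: x0_def)
      finally show "K_const \<mu> q * exp (\<gamma> * u) \<le> M_fun \<mu> q \<gamma> \<theta>" by (simp add: M_fun_def)
    qed (use comparison_pos[OF \<mu> u(1)] in \<open>simp add: less_imp_le\<close>)
    finally show ?thesis .
  qed
  show ?thesis
  proof (cases "x \<le> x0")
    case True
    then show ?thesis using small x by simp
  next
    case False
    then have xx0: "x0 < x" by simp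
    let ?R = "(\<mu> + 1 + \<theta>) / ((\<mu> + 2) * \<theta> * (\<theta> - \<gamma>))"
    have RM: "?R \<le> M_fun \<mu> q \<gamma> \<theta>" by (simp add: M_fun_def)
    have Rpos: "?R > 0" using \<mu> \<gamma> by simp
    have "damped \<mu> q \<gamma> t \<le> M_fun \<mu> q \<gamma> \<theta> * comparison_slope \<mu> q \<gamma> t" if "x0 < t" for t
    proof -
      have *: "damped \<mu> q \<gamma> t \<le> ?R * comparison_slope \<mu> q \<gamma> t"
        using damped_le_damped_slope[OF \<mu> q \<gamma>, of t] that by (simp add: x0_def)
      then have "0 \<le> ?R * comparison_slope \<mu> q \<gamma> t"
        using damped_nonneg[OF \<mu>] by (rule order_trans[rotated])
      then have "0 \<le> comparison_slope \<mu> q \<gamma> t"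
        using Rpos by (metis less_le_not_le mult_pos_neg not_le)
      with * RM show ?thesis by (meson mult_right_mono order_trans)
    qed
    then have large: "(LBINT t:{x0<..<x}. damped \<mu> q \<gamma> t)
        \<le> M_fun \<mu> q \<gamma> \<theta> * comparison \<mu> q \<gamma> x - M_fun \<mu> q \<gamma> \<theta> * comparison \<mu> q \<gamma> x0"
      using integral_damped_le_comparison(2)[OF \<mu> q less_imp_le[OF x0] xx0] by blast
    have "set_integrable lborel {0<..<x} (damped \<mu> q \<gamma>)"
      using integral_damped_le_comparison(1)[OF \<mu> q order_refl x und] by blast
    then have "(LBINT t=ereal 0..ereal x0. damped \<mu> q \<gamma> t)
        + (LBINT t=ereal x0..ereal x. damped \<mu> q \<gamma> t)
        = (LBINT t=ereal 0..ereal x. damped \<mu> q \<gamma> t)"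
      using x0 xx0
      by (intro interval_integral_sum) (simp add: interval_lebesgue_integrable_def)
    then have "(LBINT t:{0<..<x}. damped \<mu> q \<gamma> t)
        = (LBINT t:{0<..<x0}. damped \<mu> q \<gamma> t) + (LBINT t:{x0<..<x}. damped \<mu> q \<gamma> t)"
      using x0 xx0 by (simp add: interval_lebesgue_integral_def)
    also have "\<dots> \<le> M_fun \<mu> q \<gamma> \<theta> * comparison \<mu> q \<gamma> x"
      using small[of x0] large x0 by simp
    finally show ?thesis .
  qed
qed

lemma powr_bessel_I_eq_damped:
  assumes "a > -1" "t > 0"
  shows "exp (- \<gamma> * t) * t powr p * bessel_I a t = damped a (p + a) \<gamma> t / 2 powr a"
  using assms
  by (simp add: bessel_I_eq_bessel_clifford damped_def powr_divide powr_add)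

text \<open>The common factor \<open>2 powr (- \<mu>)\<close> cancels in the quotient.\<close>

lemma M_star_le_M_fun:
  assumes \<mu>: "\<mu> > -1" and q: "q \<ge> 0" and \<gamma>: "0 < \<gamma>" "\<gamma> < \<theta>" "\<theta> < 1"
  shows "M_star \<mu> q \<gamma> \<le> ereal (M_fun \<mu> q \<gamma> \<theta>)"
  unfolding M_star_def
proof (rule SUP_least)
  fix x :: real assume "x \<in> {0<..}"
  then have x: "x > 0" by simp
  have "(LBINT t:{0<..<x}. exp (- \<gamma> * t) * t powr (q - \<mu>) * bessel_I \<mu> t)
      = (LBINT t:{0<..<x}. damped \<mu> q \<gamma> t / 2 powr \<mu>)"
    using powr_bessel_I_eq_damped[OF \<mu>, of _ \<gamma> "q - \<mu>"]
    by (intro set_lebesgue_integral_cong) auto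
  also have "\<dots> = (LBINT t:{0<..<x}. damped \<mu> q \<gamma> t) / 2 powr \<mu>" by simp
  finally have num: "(LBINT t:{0<..<x}. exp (- \<gamma> * t) * t powr (q - \<mu>) * bessel_I \<mu> t)
      = (LBINT t:{0<..<x}. damped \<mu> q \<gamma> t) / 2 powr \<mu>" .
  have den: "exp (- \<gamma> * x) * x powr (q - \<mu>) * bessel_I (\<mu> + 1) x
      = comparison \<mu> q \<gamma> x / 2 powr \<mu>"
    using powr_bessel_I_eq_damped[of "\<mu> + 1" x \<gamma> "q - \<mu>"] \<mu> x
    by (simp add: comparison_def powr_add)
  have "(LBINT t:{0<..<x}. damped \<mu> q \<gamma> t) / comparison \<mu> q \<gamma> x \<le> M_fun \<mu> q \<gamma> \<theta>"
    using integral_damped_le_M_fun[OF \<mu> q \<gamma> x] comparison_pos[OF \<mu> x]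
    by (simp add: divide_le_eq)
  then show "ereal ((LBINT t:{0<..<x}. exp (- \<gamma> * t) * t powr (q - \<mu>) * bessel_I \<mu> t)
      / (exp (- \<gamma> * x) * x powr (q - \<mu>) * bessel_I (\<mu> + 1) x)) \<le> ereal (M_fun \<mu> q \<gamma> \<theta>)"
    unfolding num den by simp
qed

section \<open>The optimal parameter\<close>

lemma strict_mono_exp_branch:
  fixes c K :: real
  assumes "c > 0" "K > 0"
  shows "strict_mono_on {..<1} (\<lambda>\<theta>. K * exp (c * \<theta> / (1 - \<theta>)))"
proof (rule strict_mono_onI)
  fix r s :: real assume "r \<in> {..<1}" "s \<in> {..<1}" "r < s"
  then have "r / (1 - r) < s / (1 - s)" by (simp add: field_simps)
  then have "c * (r / (1 - r)) < c * (s / (1 - s))" using assms by (intro mult_strict_left_mono)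
  then show "K * exp (c * r / (1 - r)) < K * exp (c * s / (1 - s))" using assms by simp
qed

text \<open>
  Dividing by the parameter \<open>u\<close> puts the function in the form
  \<open>(1 + (\<mu> + 1) / u) / ((\<mu> + 2) (u - \<gamma>))\<close>: a nonincreasing numerator over a strictly
  increasing denominator.
\<close>

lemma strict_antimono_rational_branch:
  fixes \<mu> \<gamma> r s :: real
  assumes "\<mu> > -1" "0 < \<gamma>" "\<gamma> < r" "r < s"
  shows "(\<mu> + 1 + s) / ((\<mu> + 2) * s * (s - \<gamma>)) < (\<mu> + 1 + r) / ((\<mu> + 2) * r * (r - \<gamma>))"
proof -
  have split: "(\<mu> + 1 + u) / ((\<mu> + 2) * u * (u - \<gamma>)) = (1 + (\<mu> + 1) / u) / ((\<mu> + 2) * (u - \<gamma>))"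
    if "u > \<gamma>" for u
    using that assms by (simp add: field_simps)
  have "(1 + (\<mu> + 1) / s) / ((\<mu> + 2) * (s - \<gamma>)) < (1 + (\<mu> + 1) / r) / ((\<mu> + 2) * (r - \<gamma>))"
  proof (rule frac_less2)
    show "1 + (\<mu> + 1) / s \<le> 1 + (\<mu> + 1) / r"
      using assms by (auto intro!: divide_left_mono)
    show "0 < 1 + (\<mu> + 1) / s" using assms by (intro add_pos_nonneg) auto
    show "(\<mu> + 2) * (r - \<gamma>) < (\<mu> + 2) * (s - \<gamma>)" using assms by (intro mult_strict_left_mono) auto
  qed (use assms in auto)
  then show ?thesis using split assms by simp
qed

text \<open>
  The intermediate value theorem between two explicit points around the midpoint \<open>m\<close>, using
  that the rational branch is at least \<open>1 / ((\<mu> + 2) (\<theta> - \<gamma>))\<close> and the exponential branch is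
  at least \<open>c \<theta> / (1 - \<theta>)\<close>.
\<close>

lemma ex_branch_crossing:
  fixes \<mu> \<gamma> c K :: real
  assumes \<mu>: "\<mu> > -1" and \<gamma>: "0 < \<gamma>" "\<gamma> < 1" and c: "c > 0" and K: "K \<ge> 1"
  shows "\<exists>\<theta>. \<gamma> < \<theta> \<and> \<theta> < 1 \<and>
           K * exp (c * \<theta> / (1 - \<theta>)) = (\<mu> + 1 + \<theta>) / ((\<mu> + 2) * \<theta> * (\<theta> - \<gamma>))"
proof -
  define L where "L = (\<lambda>\<theta>. K * exp (c * \<theta> / (1 - \<theta>)))"
  define R where "R = (\<lambda>\<theta>. (\<mu> + 1 + \<theta>) / ((\<mu> + 2) * \<theta> * (\<theta> - \<gamma>)))"
  define m where "m = (\<gamma> + 1) / 2"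
  have m: "\<gamma> < m" "m < 1" using \<gamma> by (auto simp: m_def)
  have Lm: "L m > 0" and Rm: "R m > 0" using K \<mu> \<gamma> m by (simp_all add: L_def R_def)
  have L_mono: "L r \<le> L s" if "r \<le> s" "s < 1" for r s
    using strict_mono_on_leD[OF strict_mono_exp_branch[of c K], of r s] that c K
    by (simp add: L_def)
  have R_mono: "R s \<le> R r" if "\<gamma> < r" "r \<le> s" for r s
    using strict_antimono_rational_branch[OF \<mu> \<gamma>(1) that(1), of s] that
    by (cases "r = s") (auto simp: R_def)
  \<comment> \<open>close enough to \<open>\<gamma>\<close> that the lower bound of the rational branch is at least \<open>L m\<close>\<close>
  define \<theta>1 where "\<theta>1 = min m (\<gamma> + 1 / ((\<mu> + 2) * L m))"
  have \<theta>1: "\<gamma> < \<theta>1" "\<theta>1 \<le> m" using m Lm \<mu> by (auto simp: \<theta>1_def)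
  have "L \<theta>1 \<le> L m" using L_mono \<theta>1 m by simp
  also have "L m \<le> 1 / ((\<mu> + 2) * (\<theta>1 - \<gamma>))"
  proof -
    have "\<theta>1 - \<gamma> \<le> 1 / ((\<mu> + 2) * L m)" by (simp add: \<theta>1_def)
    then have "(\<theta>1 - \<gamma>) * ((\<mu> + 2) * L m) \<le> 1"
      using Lm \<mu> by (subst (asm) pos_le_divide_eq) auto
    then show ?thesis using \<theta>1 \<mu> by (subst pos_le_divide_eq) (auto simp: mult_ac)
  qed
  also have "\<dots> \<le> R \<theta>1"
  proof -
    have "1 / ((\<mu> + 2) * (\<theta>1 - \<gamma>)) = \<theta>1 / ((\<mu> + 2) * \<theta>1 * (\<theta>1 - \<gamma>))"
      using \<theta>1 \<gamma> by simp
    also have "\<dots> \<le> R \<theta>1" unfolding R_def using \<theta>1 \<gamma> \<mu> by (intro divide_right_mono) auto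
    finally show ?thesis .
  qed
  finally have le1: "L \<theta>1 \<le> R \<theta>1" .
  \<comment> \<open>\<open>R m / (R m + c)\<close> solves \<open>c \<theta> / (1 - \<theta>) = R m\<close>\<close>
  define \<theta>2 where "\<theta>2 = max m (R m / (R m + c))"
  have \<theta>2: "m \<le> \<theta>2" "\<theta>2 < 1" using m Rm c by (auto simp: \<theta>2_def)
  have "R \<theta>2 \<le> R m" using R_mono \<theta>2 m by simp
  also have "R m \<le> c * \<theta>2 / (1 - \<theta>2)"
  proof -
    have "R m / (R m + c) \<le> \<theta>2" by (simp add: \<theta>2_def)
    then show ?thesis using \<theta>2 Rm c by (simp add: field_simps)
  qed
  also have "\<dots> \<le> exp (c * \<theta>2 / (1 - \<theta>2))"
    using exp_ge_add_one_self[of "c * \<theta>2 / (1 - \<theta>2)"] by linarith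
  also have "\<dots> \<le> L \<theta>2" using K by (simp add: L_def)
  finally have le2: "R \<theta>2 \<le> L \<theta>2" .
  have "\<exists>\<theta>\<ge>\<theta>1. \<theta> \<le> \<theta>2 \<and> L \<theta> - R \<theta> = 0"
  proof (rule IVT')
    show "continuous_on {\<theta>1..\<theta>2} (\<lambda>\<theta>. L \<theta> - R \<theta>)"
      unfolding L_def R_def using \<theta>1 \<theta>2 \<gamma> \<mu> by (intro continuous_intros) auto
  qed (use le1 le2 \<theta>1 \<theta>2 in auto)
  then obtain \<theta> where "\<theta>1 \<le> \<theta>" "\<theta> \<le> \<theta>2" "L \<theta> = R \<theta>" by auto
  then show ?thesis using \<theta>1 \<theta>2 unfolding L_def R_def by (intro exI[of _ \<theta>]) auto
qed

theorem theorem6p6: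
  fixes \<mu> q \<gamma> :: real
  assumes "\<mu> > -1" and "q \<ge> 0" and "0 < \<gamma>" and "\<gamma> < 1"
  shows "\<exists>\<theta>. (\<theta> \<in> {\<gamma><..<1} \<and>
              K_const \<mu> q * exp (2 * \<gamma> * (\<mu> + 2) * \<theta> / (1 - \<theta>))
                = (\<mu> + 1 + \<theta>) / ((\<mu> + 2) * \<theta> * (\<theta> - \<gamma>)))
          \<and> (\<forall>\<theta>'. \<theta>' \<in> {\<gamma><..<1} \<and>
              K_const \<mu> q * exp (2 * \<gamma> * (\<mu> + 2) * \<theta>' / (1 - \<theta>'))
                = (\<mu> + 1 + \<theta>') / ((\<mu> + 2) * \<theta>' * (\<theta>' - \<gamma>)) \<longrightarrow> \<theta>' = \<theta>)
          \<and> M_hat \<mu> q \<gamma> = M_fun \<mu> q \<gamma> \<theta>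
          \<and> M_star \<mu> q \<gamma> \<le> ereal (M_hat \<mu> q \<gamma>)"
proof -
  define L where "L = (\<lambda>\<theta>. K_const \<mu> q * exp (2 * \<gamma> * (\<mu> + 2) * \<theta> / (1 - \<theta>)))"
  define R where "R = (\<lambda>\<theta>. (\<mu> + 1 + \<theta>) / ((\<mu> + 2) * \<theta> * (\<theta> - \<gamma>)))"
  have c: "2 * \<gamma> * (\<mu> + 2) > 0" and K: "K_const \<mu> q \<ge> 1"
    using assms by (auto simp: K_const_def)
  have M: "M_fun \<mu> q \<gamma> \<theta> = max (L \<theta>) (R \<theta>)" for \<theta>
    by (simp add: M_fun_def L_def R_def)
  have L_less: "L r < L s" if "r < s" "s < 1" for r s
    using strict_mono_onD[OF strict_mono_exp_branch[OF c, of "K_const \<mu> q"], of r s] that K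
    by (simp add: L_def)
  have R_less: "R s < R r" if "\<gamma> < r" "r < s" for r s
    using strict_antimono_rational_branch[OF assms(1,3) that] by (simp add: R_def)
  obtain \<theta> where \<theta>: "\<gamma> < \<theta>" "\<theta> < 1" and eq: "L \<theta> = R \<theta>"
    using ex_branch_crossing[OF assms(1,3,4) c K] by (auto simp: L_def R_def)
  have uniq: "\<theta>' = \<theta>" if "\<gamma> < \<theta>'" "\<theta>' < 1" "L \<theta>' = R \<theta>'" for \<theta>'
    using L_less[of \<theta> \<theta>'] L_less[of \<theta>' \<theta>] R_less[of \<theta> \<theta>'] R_less[of \<theta>' \<theta>] that \<theta> eq
    by linarith
  have min: "M_fun \<mu> q \<gamma> \<theta> \<le> M_fun \<mu> q \<gamma> \<theta>'" if "\<gamma> < \<theta>'" "\<theta>' < 1" for \<theta>'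
    using L_less[of \<theta> \<theta>'] R_less[of \<theta>' \<theta>] that \<theta> eq
    by (cases \<theta> \<theta>' rule: linorder_cases) (auto simp: M)
  have hat: "M_hat \<mu> q \<gamma> = M_fun \<mu> q \<gamma> \<theta>"
    unfolding M_hat_def using \<theta> min by (intro cInf_eq_minimum) auto
  have star: "M_star \<mu> q \<gamma> \<le> ereal (M_hat \<mu> q \<gamma>)"
    unfolding hat using assms \<theta> by (intro M_star_le_M_fun) auto
  have "\<theta> \<in> {\<gamma><..<1}" using \<theta> by simp
  moreover have "\<forall>\<theta>'. \<theta>' \<in> {\<gamma><..<1} \<and> L \<theta>' = R \<theta>' \<longrightarrow> \<theta>' = \<theta>"
    using uniq by (meson greaterThanLessThan_iff)
  ultimately show ?thesis using eq hat star unfolding L_def R_def by (intro exI[of _ \<theta>] conjI)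
qed

end
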